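(* Suppose one observes a rooted unlabelled BCMRT of size $2n$, and let $\mathbf R^\star_{q_0,q_1}=\mathbf R^\star_{q_0,q_1}(n)$ denote the optimal risk for testing $H_0:q=q_0$ against $H_1:q=q_1$ from this observation. Then, for all $0\le q_0<q_1\le1/2$, $$\sup_{n\ge2}\mathbf R^\star_{q_0,q_1}(n)<\frac12 .$$
   Context: BCMRT$(q)$ (balanced community modulated random recursive tree), $q\in[0,1]$: $T_1$ is a single edge (the root edge) joining two nodes with time-label $1$, one of type $A$, denoted $(1,A)$, and one of type $B$, denoted $(1,B)$. At each step $n\ge 2$, two new nodes with time-label $n$, namely $(n,A)$ of type $A$ and $(n,B)$ of type $B$, are added to the tree $T_{n-1}$ of size $2(n-1)$: (1) the two nodes independently (of each other and of the past) decide to connect to a node of their own type with probability $1-q$, or to a node of the other type with probability $q$; (2) each then independently chooses its parent uniformly among the $n-1$ nodes of $T_{n-1}$ of the selected type and is joined to it by an edge. This yields the tree $T_n$ of size $2n$. The rooted unlabelled BCMRT of size $2n$ is the tree $T_n$ without types and without time labels, but with the root edge (joining the two initial nodes) distinguished; i.e. $T_n$ up to isomorphism of trees with a distinguished edge. A test $\varphi$ is a function from the set of possible observations to $\{0,1\}$; writing $\mathbf P_q$ for the law under BCMRT$(q)$, its risk is $\mathbf R_{q_0,q_1}(\varphi)=\frac12\left(\mathbf P_{q_0}(\varphi=1)+\mathbf P_{q_1}(\varphi=0)\right)$, and $\mathbf R^\star_{q_0,q_1}=\inf_\varphi\mathbf R_{q_0,q_1}(\varphi)$, the infimum being over all tests.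 *)

theory Defs
  imports "HOL-Probability.Probability"
begin

datatype community = Type_A | Type_B

fun other :: "community \<Rightarrow> community" where
  "other Type_A = Type_B"
| "other Type_B = Type_A"

text \<open>A node is a pair of its time label and its type; edges are unordered pairs of nodes.\<close>

type_synonym node = "nat \<times> community"

definition root_edge :: "node set" where
  "root_edge = {(1, Type_A), (1, Type_B)}"

definition nodes :: "nat \<Rightarrow> node set" where
  "nodes n = {1..n} \<times> UNIV"

text \<open>\<open>parent_pmf q m t\<close> is the law of the parent, in the tree of size \<open>2 * m\<close>,
  of an arriving node of type \<open>t\<close>.\<close>

definition parent_pmf :: "real \<Rightarrow> nat \<Rightarrow> community \<Rightarrow> node pmf" where
  "parent_pmf q m t = do {
     cross \<leftarrow> bernoulli_pmf q;
     pmf_of_set ({1..m} \<times> {if cross then other t else t})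
   }"

text \<open>\<open>bcmrt q n\<close> is the law of the edge set of the tree \<open>T\<^sub>n\<close>, whose node set is
  \<open>nodes n\<close>; types and time labels are carried by the names of the nodes. The value at \<open>0\<close>
  is a dummy.\<close>

fun bcmrt :: "real \<Rightarrow> nat \<Rightarrow> node set set pmf" where
  "bcmrt q 0 = return_pmf {}"
| "bcmrt q (Suc 0) = return_pmf {root_edge}"
| "bcmrt q (Suc (Suc m)) = do {
     E \<leftarrow> bcmrt q (Suc m);
     a \<leftarrow> parent_pmf q (Suc m) Type_A;
     b \<leftarrow> parent_pmf q (Suc m) Type_B;
     return_pmf (E \<union> {{(Suc (Suc m), Type_A), a}, {(Suc (Suc m), Type_B), b}})
   }"

text \<open>Graphs with a distinguished edge, given by node set, edge set and distinguished edge.\<close>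

type_synonym 'v rooted_graph = "'v set \<times> 'v set set \<times> 'v set"

definition rooted_iso :: "'v rooted_graph \<Rightarrow> 'v rooted_graph \<Rightarrow> bool" where
  "rooted_iso G H = (case (G, H) of ((V, E, e), (V', E', e')) \<Rightarrow>
     \<exists>f. bij_betw f V V' \<and> (`) f ` E = E' \<and> f ` e = e')"

text \<open>An unlabelled rooted graph is an isomorphism class.\<close>

definition unlabelled :: "'v rooted_graph \<Rightarrow> 'v rooted_graph set" where
  "unlabelled G = {H. rooted_iso G H}"

definition rooted_unlabelled_bcmrt :: "real \<Rightarrow> nat \<Rightarrow> node rooted_graph set pmf" where
  "rooted_unlabelled_bcmrt q n =
     map_pmf (\<lambda>E. unlabelled (nodes n, E, root_edge)) (bcmrt q n)"

text \<open>Tests are \<open>bool\<close>-valued, with \<open>True\<close> standing for \<open>1\<close> (reject \<open>H\<^sub>0\<close>). They are total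
  functions, but only their values on the support of the observation enter the risk.\<close>

definition risk :: "real \<Rightarrow> real \<Rightarrow> nat \<Rightarrow> (node rooted_graph set \<Rightarrow> bool) \<Rightarrow> real" where
  "risk q0 q1 n \<phi> =
     (measure_pmf.prob (rooted_unlabelled_bcmrt q0 n) {x. \<phi> x} +
      measure_pmf.prob (rooted_unlabelled_bcmrt q1 n) {x. \<not> \<phi> x}) / 2"

definition optimal_risk :: "real \<Rightarrow> real \<Rightarrow> nat \<Rightarrow> real" where
  "optimal_risk q0 q1 n = (INF \<phi>. risk q0 q1 n \<phi>)"

text \<open>The infimum above and the supremum of the optimal risks over \<open>n\<close> are genuine, since the
  sets involved are nonempty and bounded.\<close>

lemma risk_nonneg: "0 \<le> risk q0 q1 n \<phi>"
  by (simp add: risk_def)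

lemma bdd_below_risk: "bdd_below (range (risk q0 q1 n))"
  by (meson bdd_belowI2 risk_nonneg)

lemma optimal_risk_nonneg: "0 \<le> optimal_risk q0 q1 n"
  unfolding optimal_risk_def by (rule cINF_greatest) (auto simp: risk_nonneg)

lemma optimal_risk_le_half: "optimal_risk q0 q1 n \<le> 1 / 2"
proof -
  have "optimal_risk q0 q1 n \<le> risk q0 q1 n (\<lambda>_. False)"
    unfolding optimal_risk_def by (rule cINF_lower[OF bdd_below_risk]) simp
  also have "\<dots> = 1 / 2"
    using measure_pmf.prob_space[of "rooted_unlabelled_bcmrt q1 n"] by (simp add: risk_def)
  finally show ?thesis .
qed

lemma bdd_above_optimal_risk: "bdd_above (optimal_risk q0 q1 ` N)"
  by (meson bdd_aboveI2 optimal_risk_le_half)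

end

theory Submission
  imports Defs
begin

text \<open>Removing the root edge splits the tree into two parts; colour the nodes of one part by \<open>1\<close>
  and those of the other by \<open>-1\<close>. The square \<open>D\<^sup>2\<close> of the sum of all colours depends on the
  unlabelled tree only. Let \<open>W\<close> be the sum of the colours over type \<open>A\<close> minus the sum over
  type \<open>B\<close>, and \<open>\<theta> = 1 - 2q\<close>. One step of the growth from size \<open>2n\<close> gives
  \<open>E D'\<^sup>2 = (1 + 2/n + 1/(2n\<^sup>2)) E D\<^sup>2 + 2 - \<theta>\<^sup>2/(2n\<^sup>2) E W\<^sup>2\<close> and
  \<open>E W'\<^sup>2 = (1 + 2\<theta>/n + \<theta>\<^sup>2/(2n\<^sup>2)) E W\<^sup>2 + 2 - 1/(2n\<^sup>2) E D\<^sup>2\<close>.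
  This system is monotone: a smaller \<open>\<theta>\<close> means a smaller \<open>E W\<^sup>2\<close> and a larger \<open>E D\<^sup>2\<close>. The gap
  between the two values of \<open>E D\<^sup>2\<close> is positive at \<open>n = 2\<close> and is multiplied by at least
  \<open>1 + 2/n\<close> in each step, hence is of order \<open>n\<^sup>2\<close>. So the statistic \<open>(D/(2n))\<^sup>2\<close>, with
  values in \<open>[0,1]\<close>, separates the two laws uniformly in \<open>n\<close>.\<close>

section \<open>Expectations of finitely supported laws\<close>

lemma expectation_bind_pmf_finite:
  fixes h :: "'b \<Rightarrow> real"
  assumes "finite (set_pmf p)" and "\<And>x. x \<in> set_pmf p \<Longrightarrow> finite (set_pmf (f x))"
  shows "measure_pmf.expectation (bind_pmf p f) h =
    measure_pmf.expectation p (\<lambda>x. measure_pmf.expectation (f x) h)"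
  using assms
  by (simp add: pmf_expectation_bind[where A = "set_pmf p"]
    integral_measure_pmf_real[where A = "set_pmf p"] mult.commute)

text \<open>The likelihood ratio test works: the indicator of \<open>pmf P0 x < pmf P1 x\<close>
  maximises \<open>g x * (pmf P1 x - pmf P0 x)\<close> at every point among weights
  \<open>g x\<close> in \<open>[0,1]\<close>. A bounded statistic with different means thus yields a
  test.\<close>

lemma ex_test_of_expectation_gap:
  fixes f :: "'a \<Rightarrow> real"
  assumes fin: "finite (set_pmf P0)" "finite (set_pmf P1)"
    and f: "\<And>x. x \<in> set_pmf P0 \<union> set_pmf P1 \<Longrightarrow> 0 \<le> f x \<and> f x \<le> 1"
  obtains \<phi> where "measure_pmf.expectation P1 f - measure_pmf.expectation P0 f
    \<le> measure_pmf.prob P1 {x. \<phi> x} - measure_pmf.prob P0 {x. \<phi> x}"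
proof
  define \<phi> where "\<phi> x \<longleftrightarrow> pmf P0 x < pmf P1 x" for x
  define S where "S = set_pmf P0 \<union> set_pmf P1"
  have S: "finite S" using fin by (simp add: S_def)
  have E: "measure_pmf.expectation P g = (\<Sum>x\<in>S. g x * pmf P x)"
    if "P \<in> {P0, P1}" for P and g :: "'a \<Rightarrow> real"
    using that by (intro integral_measure_pmf_real S) (auto simp: S_def)
  have Pr: "measure_pmf.prob P {x. \<phi> x} = (\<Sum>x\<in>S. indicator {x. \<phi> x} x * pmf P x)"
    if "P \<in> {P0, P1}" for P
    using E[OF that, of "indicator {x. \<phi> x}"] by simp
  have "(\<Sum>x\<in>S. f x * (pmf P1 x - pmf P0 x))
    \<le> (\<Sum>x\<in>S. indicator {x. \<phi> x} x * (pmf P1 x - pmf P0 x))"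
  proof (rule sum_mono)
    fix x assume "x \<in> S"
    then have "0 \<le> f x" "f x \<le> 1" using f by (auto simp: S_def)
    then show "f x * (pmf P1 x - pmf P0 x) \<le> indicator {x. \<phi> x} x * (pmf P1 x - pmf P0 x)"
      by (auto simp: \<phi>_def indicator_def mult_left_le_one_le mult_nonneg_nonpos)
  qed
  then show "measure_pmf.expectation P1 f - measure_pmf.expectation P0 f
    \<le> measure_pmf.prob P1 {x. \<phi> x} - measure_pmf.prob P0 {x. \<phi> x}"
    by (simp add: E Pr sum_subtractf right_diff_distrib)
qed

section \<open>Splitting a rooted graph at its distinguished edge\<close>

text \<open>For a tree with distinguished edge \<open>e\<close>, these are the two colourings by the
  components left after removing \<open>e\<close>. Stating this edge by edge avoids paths and
  connectedness, so it transports along isomorphisms directly.\<close>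

definition splits :: "'v rooted_graph \<Rightarrow> ('v \<Rightarrow> real) \<Rightarrow> bool" where
  "splits G s = (case G of (V, E, e) \<Rightarrow> s ` V \<subseteq> {1, -1} \<and>
     (\<forall>\<epsilon>\<in>E - {e}. \<forall>x\<in>\<epsilon>. \<forall>y\<in>\<epsilon>. s x = s y) \<and> s ` e = {1, -1})"

lemma splitsI:
  assumes "\<And>x. x \<in> V \<Longrightarrow> s x \<in> {1, -1}"
    and "\<And>\<epsilon> x y. \<lbrakk>\<epsilon> \<in> E; \<epsilon> \<noteq> e; x \<in> \<epsilon>; y \<in> \<epsilon>\<rbrakk> \<Longrightarrow> s x = s y"
    and "s ` e = {1, -1}"
  shows "splits (V, E, e) s"
  unfolding splits_def split_conv using assms by (intro conjI ballI image_subsetI) blast+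

lemma
  assumes "splits (V, E, e) s"
  shows splits_colour: "x \<in> V \<Longrightarrow> s x \<in> {1, -1}"
    and splits_edge: "\<lbrakk>\<epsilon> \<in> E; \<epsilon> \<noteq> e; x \<in> \<epsilon>; y \<in> \<epsilon>\<rbrakk> \<Longrightarrow> s x = s y"
    and splits_root: "s ` e = {1, -1}"
proof -
  note conj = assms[unfolded splits_def split_conv]
  show "x \<in> V \<Longrightarrow> s x \<in> {1, -1}"
    using conj[THEN conjunct1] by blast
  show "\<lbrakk>\<epsilon> \<in> E; \<epsilon> \<noteq> e; x \<in> \<epsilon>; y \<in> \<epsilon>\<rbrakk> \<Longrightarrow> s x = s y"
    by (rule conj[THEN conjunct2, THEN conjunct1, THEN bspec, THEN bspec, THEN bspec]) simp_all
  show "s ` e = {1, -1}"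
    by (rule conj[THEN conjunct2, THEN conjunct2])
qed

lemma splits_pullback:
  assumes f: "bij_betw f V V'" "(`) f ` E = E'" "f ` e = e'"
    and sub: "E \<subseteq> Pow V" "e \<subseteq> V" and s: "splits (V', E', e') s"
  shows "splits (V, E, e) (s \<circ> f)"
proof (rule splitsI)
  show "(s \<circ> f) x \<in> {1, -1}" if "x \<in> V" for x
    using splits_colour[OF s, of "f x"] bij_betwE[OF f(1)] that by simp
next
  fix \<epsilon> x y assume \<epsilon>: "\<epsilon> \<in> E" "\<epsilon> \<noteq> e" and xy: "x \<in> \<epsilon>" "y \<in> \<epsilon>"
  have "\<epsilon> \<subseteq> V" using \<epsilon>(1) sub(1) by blast
  \<comment> \<open>Injectivity of \<open>f\<close> on \<open>V\<close> keeps the image of an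
    ordinary edge distinct from the image of the root edge; this is where both edges must lie inside
    \<open>V\<close>.\<close>
  then have "f ` \<epsilon> \<noteq> e'"
    using inj_on_image_eq_iff[OF bij_betw_imp_inj_on[OF f(1)], of \<epsilon> e] \<epsilon>(2) sub(2) f(3) by simp
  moreover have "f ` \<epsilon> \<in> E'"
    unfolding f(2)[symmetric] using \<epsilon>(1) by (rule imageI)
  ultimately have "s (f x) = s (f y)"
    using xy by (intro splits_edge[OF s, of "f ` \<epsilon>"] imageI) simp_all
  then show "(s \<circ> f) x = (s \<circ> f) y" by simp
next
  show "(s \<circ> f) ` e = {1, -1}"
    by (simp only: image_comp[of s f e, symmetric] f(3) splits_root[OF s])
qed

text \<open>An isomorphism class carries no preferred representative or colouring, hence the choice.
  Squaring removes the ambiguity of the global sign.\<close>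

definition imbalance :: "'v rooted_graph set \<Rightarrow> real" where
  "imbalance X = (SOME d. \<exists>V E e s. (V, E, e) \<in> X \<and> splits (V, E, e) s \<and> d = (sum s V)\<^sup>2)"

text \<open>Any splitting of any representative pulls back to a splitting of the given graph, which
  is \<open>s\<close> up to a global sign. The bijection preserves the sum, so all candidates for
  the choice have the same square.\<close>

lemma imbalance_unlabelled:
  assumes sub: "E \<subseteq> Pow V" "e \<subseteq> V" and s: "splits (V, E, e) s"
    and unique: "\<And>s'. splits (V, E, e) s' \<Longrightarrow> \<exists>c\<in>{1, -1}. \<forall>x\<in>V. s' x = c * s x"
  shows "imbalance (unlabelled (V, E, e)) = (sum s V)\<^sup>2"
  unfolding imbalance_def
proof (rule some_equality)
  have "rooted_iso (V, E, e) (V, E, e)"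
    unfolding rooted_iso_def by (auto intro!: exI[of _ id])
  then show "\<exists>V' E' e' s'. (V', E', e') \<in> unlabelled (V, E, e) \<and> splits (V', E', e') s' \<and>
      (sum s V)\<^sup>2 = (sum s' V')\<^sup>2"
    using s unfolding unlabelled_def by blast
next
  fix d
  assume "\<exists>V' E' e' s'. (V', E', e') \<in> unlabelled (V, E, e) \<and> splits (V', E', e') s' \<and>
      d = (sum s' V')\<^sup>2"
  then obtain V' E' e' s' where iso: "rooted_iso (V, E, e) (V', E', e')"
    and s': "splits (V', E', e') s'" and d: "d = (sum s' V')\<^sup>2"
    unfolding unlabelled_def by blast
  from iso obtain f where f: "bij_betw f V V'" "(`) f ` E = E'" "f ` e = e'"
    unfolding rooted_iso_def by auto
  obtain c where c: "c \<in> {1, -1}" "\<forall>x\<in>V. (s' \<circ> f) x = c * s x"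
    using unique[OF splits_pullback[OF f sub s']] by blast
  have "sum s' V' = (\<Sum>x\<in>V. s' (f x))"
    by (simp add: sum.reindex_bij_betw[OF f(1)])
  also have "\<dots> = c * sum s V"
    using c by (simp add: sum_distrib_left)
  finally show "d = (sum s V)\<^sup>2" using c d by (auto simp: power_mult_distrib)
qed

section \<open>The coloured tree\<close>

text \<open>\<open>coloured q m\<close> is the joint law of the edges of \<open>T\<^sub>m\<^sub>+\<^sub>1\<close> and of the colouring that gives
  \<open>1\<close> to the part of \<open>(1, Type_A)\<close>.\<close>

definition grow :: "nat \<Rightarrow> node \<Rightarrow> node \<Rightarrow> node set set \<times> (node \<Rightarrow> real) \<Rightarrow>
    node set set \<times> (node \<Rightarrow> real)" where
  "grow m a b = (\<lambda>(E, s). (E \<union> {{(Suc (Suc m), Type_A), a}, {(Suc (Suc m), Type_B), b}},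
     s((Suc (Suc m), Type_A) := s a, (Suc (Suc m), Type_B) := s b)))"

fun coloured :: "real \<Rightarrow> nat \<Rightarrow> (node set set \<times> (node \<Rightarrow> real)) pmf" where
  "coloured q 0 = return_pmf ({root_edge}, \<lambda>x. if x = (1, Type_A) then 1 else -1)"
| "coloured q (Suc m) = do {
     G \<leftarrow> coloured q m;
     a \<leftarrow> parent_pmf q (Suc m) Type_A;
     b \<leftarrow> parent_pmf q (Suc m) Type_B;
     return_pmf (grow m a b G)
   }"

text \<open>The colouring adds no randomness: each new colour is copied from the parent already
  drawn.\<close>

lemma map_fst_coloured: "map_pmf fst (coloured q m) = bcmrt q (Suc m)"
proof (induction m)
  case (Suc m)
  show ?case
    unfolding bcmrt.simps(3) Suc.IH[symmetric] bind_map_pmf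
    by (simp add: map_bind_pmf grow_def case_prod_beta)
qed simp

lemma UNIV_community: "(UNIV :: community set) = {Type_A, Type_B}"
  using community.exhaust by auto

lemma finite_nodes [simp]: "finite (nodes n)"
  by (simp add: nodes_def UNIV_community)

lemma nodes_Suc: "nodes (Suc n) = insert (Suc n, Type_A) (insert (Suc n, Type_B) (nodes n))"
  by (auto simp: nodes_def UNIV_community atLeastAtMostSuc_conv)

lemma set_parent_pmf: "set_pmf (parent_pmf q (Suc m) t) \<subseteq> nodes (Suc m)"
  by (auto simp: parent_pmf_def nodes_def)

lemma finite_parent_pmf [simp]: "finite (set_pmf (parent_pmf q (Suc m) t))"
  by (rule finite_subset[OF set_parent_pmf]) simp

lemma finite_coloured [simp]: "finite (set_pmf (coloured q m))"
  by (induction m) auto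

text \<open>The growth invariant, standing in for the fact that the graph is a tree. Agreement up to
  sign is demanded on \<open>nodes n\<close> only, since colourings are total functions.\<close>

definition uniquely_split :: "nat \<Rightarrow> node set set \<times> (node \<Rightarrow> real) \<Rightarrow> bool" where
  "uniquely_split n G = (case G of (E, s) \<Rightarrow> E \<subseteq> Pow (nodes n) \<and> splits (nodes n, E, root_edge) s \<and>
     (\<forall>s'. splits (nodes n, E, root_edge) s' \<longrightarrow> (\<exists>c\<in>{1, -1}. \<forall>x\<in>nodes n. s' x = c * s x)))"

text \<open>Each new node is a leaf whose edge to its parent is not the root edge, so its colour is
  forced. The sign \<open>c\<close> found on the old tree therefore persists on the new one.\<close>

lemma uniquely_split_grow:
  assumes G: "uniquely_split (Suc m) G" and a: "a \<in> nodes (Suc m)" and b: "b \<in> nodes (Suc m)"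
  shows "uniquely_split (Suc (Suc m)) (grow m a b G)"
proof -
  obtain E s where Es: "G = (E, s)" by (cases G)
  let ?A = "(Suc (Suc m), Type_A)" and ?B = "(Suc (Suc m), Type_B)"
  let ?V = "nodes (Suc m)" and ?V' = "nodes (Suc (Suc m))"
  let ?s = "s(?A := s a, ?B := s b)"
  let ?E = "E \<union> {{?A, a}, {?B, b}}"
  have new: "?A \<notin> ?V" "?B \<notin> ?V" by (auto simp: nodes_def)
  have root: "root_edge \<subseteq> ?V" by (auto simp: root_edge_def nodes_def)
  have ne: "a \<noteq> ?A" "a \<noteq> ?B" "b \<noteq> ?A" "b \<noteq> ?B" using new a b by auto
  have old: "?s x = s x" if "x \<in> ?V" for x using that new by auto
  have E: "E \<subseteq> Pow ?V" and s: "splits (?V, E, root_edge) s"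
    and unique: "\<And>s'. splits (?V, E, root_edge) s' \<Longrightarrow> \<exists>c\<in>{1, -1}. \<forall>x\<in>?V. s' x = c * s x"
    using G by (auto simp: uniquely_split_def Es)
  have "?E \<subseteq> Pow ?V'"
    using E a b by (auto simp: nodes_Suc)
  moreover have "splits (?V', ?E, root_edge) ?s"
  proof (rule splitsI)
    show "?s x \<in> {1, -1}" if "x \<in> ?V'" for x
      using splits_colour[OF s] a b that by (cases x) (auto simp: nodes_Suc[of "Suc m"])
  next
    fix \<epsilon> x y assume \<epsilon>: "\<epsilon> \<in> ?E" "\<epsilon> \<noteq> root_edge" and xy: "x \<in> \<epsilon>" "y \<in> \<epsilon>"
    show "?s x = ?s y"
    proof (cases "\<epsilon> \<in> E")
      case True
      then have "?s x = s x" "?s y = s y" using old E xy by blast+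
      then show ?thesis using splits_edge[OF s True \<epsilon>(2) xy] by simp
    qed (use \<epsilon> xy ne in auto)
  next
    have "?s ` root_edge = s ` root_edge"
      by (intro image_cong refl old subsetD[OF root])
    then show "?s ` root_edge = {1, -1}" using splits_root[OF s] by simp
  qed
  moreover have "\<exists>c\<in>{1, -1}. \<forall>x\<in>?V'. s' x = c * ?s x" if s': "splits (?V', ?E, root_edge) s'" for s'
  proof -
    have "splits (?V, E, root_edge) s'"
    proof (rule splitsI)
      show "s' x \<in> {1, -1}" if "x \<in> ?V" for x
        using splits_colour[OF s'] that by (simp add: nodes_Suc[of "Suc m"])
      show "s' x = s' y" if "\<epsilon> \<in> E" "\<epsilon> \<noteq> root_edge" "x \<in> \<epsilon>" "y \<in> \<epsilon>" for \<epsilon> x y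
        by (rule splits_edge[OF s' UnI1[OF that(1)] that(2-4)])
    qed (rule splits_root[OF s'])
    from unique[OF this] obtain c where c: "c \<in> {1, -1}" "\<And>x. x \<in> ?V \<Longrightarrow> s' x = c * s x" by blast
    have "{?A, a} \<noteq> root_edge" "{?B, b} \<noteq> root_edge"
      using new root by auto
    then have "s' ?A = s' a" "s' ?B = s' b"
      by (auto intro: splits_edge[OF s', of "{?A, a}"] splits_edge[OF s', of "{?B, b}"])
    then have "\<forall>x\<in>?V'. s' x = c * ?s x"
      using c a b old by (auto simp: nodes_Suc[of "Suc m"])
    then show ?thesis using c(1) by blast
  qed
  ultimately show ?thesis by (simp add: uniquely_split_def grow_def Es)
qed

lemma uniquely_split_coloured: "G \<in> set_pmf (coloured q m) \<Longrightarrow> uniquely_split (Suc m) G"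
proof (induction m arbitrary: G)
  case 0
  let ?s = "\<lambda>x. if x = (1, Type_A) then 1 else (-1 :: real)"
  have nodes_1: "nodes (Suc 0) = root_edge" by (auto simp: nodes_def root_edge_def UNIV_community)
  have "\<exists>c\<in>{1, -1}. \<forall>x\<in>root_edge. s' x = c * ?s x" if "s' ` root_edge = {1, -1}" for s'
    using that by (auto simp: root_edge_def doubleton_eq_iff)
  moreover have "splits (root_edge, {root_edge}, root_edge) ?s"
    by (rule splitsI) (auto simp: root_edge_def)
  ultimately show ?case
    using 0 by (simp add: uniquely_split_def nodes_1 splits_root)
next
  case (Suc m)
  then show ?case using set_parent_pmf by (fastforce intro!: uniquely_split_grow)
qed

section \<open>Second moments\<close>

definition colour_sum :: "nat \<Rightarrow> (node \<Rightarrow> real) \<Rightarrow> community \<Rightarrow> real" where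
  "colour_sum n s t = (\<Sum>i=1..n. s (i, t))"

lemma expectation_parent:
  assumes "0 \<le> q" "q \<le> 1"
  shows "measure_pmf.expectation (parent_pmf q (Suc m) t) s =
    ((1 - q) * colour_sum (Suc m) s t + q * colour_sum (Suc m) s (other t)) / real (Suc m)"
proof -
  have u: "measure_pmf.expectation (pmf_of_set ({1..Suc m} \<times> {t})) s
      = colour_sum (Suc m) s t / real (Suc m)" for t
  proof -
    have "sum s ({1..Suc m} \<times> {t}) = colour_sum (Suc m) s t"
      unfolding colour_sum_def
      by (rule sum.reindex_cong[where l = "\<lambda>i. (i, t)"]) (auto simp: inj_on_def)
    then show ?thesis by (subst integral_pmf_of_set) (auto simp: card_cartesian_product)
  qed
  show ?thesis
    unfolding parent_pmf_def
    by (subst expectation_bind_pmf_finite) (use assms u in \<open>auto simp: add_divide_distrib ac_simps\<close>)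
qed

text \<open>All of \<open>s a\<close>, \<open>s b\<close> and \<open>k\<close> square to 1, so the
  square terms contribute the constant 2. The rest is linear in each of \<open>s a\<close> and
  \<open>s b\<close> separately, and the iterated expectation (independence of the two parents)
  factorises the cross term.\<close>

lemma expectation_square_step:
  assumes fin: "finite (set_pmf p)" "finite (set_pmf p')"
    and one: "\<And>a. a \<in> set_pmf p \<Longrightarrow> (s a)\<^sup>2 = 1" "\<And>b. b \<in> set_pmf p' \<Longrightarrow> (s b)\<^sup>2 = 1"
    and k: "k\<^sup>2 = (1::real)"
  shows "measure_pmf.expectation p (\<lambda>a. measure_pmf.expectation p' (\<lambda>b. (x + s a + k * s b)\<^sup>2)) =
    x\<^sup>2 + 2 + 2 * x * (measure_pmf.expectation p s + k * measure_pmf.expectation p' s)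
      + 2 * k * measure_pmf.expectation p s * measure_pmf.expectation p' s"
proof -
  let ?e = "measure_pmf.expectation p s" and ?e' = "measure_pmf.expectation p' s"
  have [simp]: "integrable p f" "integrable p' f" for f :: "_ \<Rightarrow> real"
    using fin by (auto intro: integrable_measure_pmf_finite)
  have inner: "measure_pmf.expectation p' (\<lambda>b. (x + s a + k * s b)\<^sup>2)
      = (x\<^sup>2 + 2 + 2 * x * k * ?e') + (2 * x + 2 * k * ?e') * s a" if "a \<in> set_pmf p" for a
  proof -
    have "measure_pmf.expectation p' (\<lambda>b. (x + s a + k * s b)\<^sup>2)
        = measure_pmf.expectation p' (\<lambda>b. (x\<^sup>2 + 2 + 2 * x * s a) + (2 * k * (x + s a)) * s b)"
    proof (rule integral_cong_AE)
      show "AE b in p'. (x + s a + k * s b)\<^sup>2 = (x\<^sup>2 + 2 + 2 * x * s a) + (2 * k * (x + s a)) * s b"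
      proof (rule AE_pmfI)
        fix b assume "b \<in> set_pmf p'"
        have "(x + s a + k * s b)\<^sup>2
            = (x\<^sup>2 + (s a)\<^sup>2 + k\<^sup>2 * (s b)\<^sup>2 + 2 * x * s a) + (2 * k * (x + s a)) * s b"
          by (simp add: power2_eq_square algebra_simps)
        then show "(x + s a + k * s b)\<^sup>2 = (x\<^sup>2 + 2 + 2 * x * s a) + (2 * k * (x + s a)) * s b"
          using one \<open>a \<in> set_pmf p\<close> \<open>b \<in> set_pmf p'\<close> k by simp
      qed
    qed simp_all
    also have "\<dots> = (x\<^sup>2 + 2 + 2 * x * s a) + (2 * k * (x + s a)) * ?e'"
      by simp
    finally show ?thesis by (simp add: algebra_simps)
  qed
  have "measure_pmf.expectation p (\<lambda>a. measure_pmf.expectation p' (\<lambda>b. (x + s a + k * s b)\<^sup>2))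
      = measure_pmf.expectation p (\<lambda>a. (x\<^sup>2 + 2 + 2 * x * k * ?e') + (2 * x + 2 * k * ?e') * s a)"
    by (rule integral_cong_AE) (auto intro!: AE_pmfI simp: inner)
  also have "\<dots> = (x\<^sup>2 + 2 + 2 * x * k * ?e') + (2 * x + 2 * k * ?e') * ?e"
    by simp
  finally show ?thesis by (simp add: algebra_simps)
qed

text \<open>\<open>D\<close> and \<open>W\<close> are the signed sums with \<open>k = 1\<close> and \<open>k = -1\<close>; these signs are the
  eigenvectors of the type-switching matrix, with eigenvalues \<open>(1 - q) + k q\<close>.\<close>

definition signed_sum :: "real \<Rightarrow> nat \<Rightarrow> node set set \<times> (node \<Rightarrow> real) \<Rightarrow> real" where
  "signed_sum k n G = colour_sum n (snd G) Type_A + k * colour_sum n (snd G) Type_B"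

lemma signed_sum_grow:
  assumes "a \<in> nodes (Suc m)" "b \<in> nodes (Suc m)"
  shows "signed_sum k (Suc (Suc m)) (grow m a b G) =
    signed_sum k (Suc m) G + snd G a + k * snd G b"
  by (cases G) (simp add: signed_sum_def colour_sum_def grow_def algebra_simps)

definition second_moment :: "real \<Rightarrow> real \<Rightarrow> nat \<Rightarrow> real" where
  "second_moment k q m = measure_pmf.expectation (coloured q m) (\<lambda>G. (signed_sum k (Suc m) G)\<^sup>2)"

lemma second_moment_nonneg: "0 \<le> second_moment k q m"
  by (simp add: second_moment_def)

lemma expectation_signed_sum_step:
  assumes q: "0 \<le> q" "q \<le> 1" and k: "k \<in> {1, -1}" and G: "G \<in> set_pmf (coloured q m)"
  defines "n \<equiv> real (Suc m)" and "\<theta> \<equiv> 1 - 2 * q"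
  defines "D \<equiv> signed_sum 1 (Suc m) G" and "W \<equiv> signed_sum (-1) (Suc m) G"
    and "x \<equiv> signed_sum k (Suc m) G"
  shows "measure_pmf.expectation (parent_pmf q (Suc m) Type_A) (\<lambda>a.
      measure_pmf.expectation (parent_pmf q (Suc m) Type_B) (\<lambda>b.
        (signed_sum k (Suc (Suc m)) (grow m a b G))\<^sup>2))
    = x\<^sup>2 * (1 + 2 * ((1 - q) + k * q) / n) + 2 + k * (D\<^sup>2 - \<theta>\<^sup>2 * W\<^sup>2) / (2 * n\<^sup>2)"
proof -
  let ?p = "parent_pmf q (Suc m) Type_A" and ?p' = "parent_pmf q (Suc m) Type_B"
  define s where "s = snd G"
  define \<alpha> where "\<alpha> = colour_sum (Suc m) s Type_A"
  define \<beta> where "\<beta> = colour_sum (Suc m) s Type_B"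
  have n: "n > 0" by (simp add: n_def)
  have "splits (nodes (Suc m), fst G, root_edge) s"
    using uniquely_split_coloured[OF G] by (simp add: uniquely_split_def case_prod_beta s_def)
  then have sq: "(s a)\<^sup>2 = 1" if "a \<in> set_pmf (parent_pmf q (Suc m) t)" for a t
    using splits_colour subsetD[OF set_parent_pmf that] by fastforce
  have "measure_pmf.expectation ?p (\<lambda>a. measure_pmf.expectation ?p' (\<lambda>b.
        (signed_sum k (Suc (Suc m)) (grow m a b G))\<^sup>2))
      = measure_pmf.expectation ?p (\<lambda>a. measure_pmf.expectation ?p' (\<lambda>b. (x + s a + k * s b)\<^sup>2))"
    by (intro integral_cong_AE AE_pmfI)
       (auto simp: x_def s_def intro!: integral_cong_AE AE_pmfI
         signed_sum_grow[THEN arg_cong[where f = "\<lambda>x. x\<^sup>2"]] dest!: subsetD[OF set_parent_pmf])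
  also have "\<dots> = x\<^sup>2 + 2 + 2 * x * (((1 - q) * \<alpha> + q * \<beta>) / n + k * (((1 - q) * \<beta> + q * \<alpha>) / n))
      + 2 * k * (((1 - q) * \<alpha> + q * \<beta>) / n) * (((1 - q) * \<beta> + q * \<alpha>) / n)"
    by (subst expectation_square_step)
       (use sq k in \<open>auto simp: expectation_parent[OF q] \<alpha>_def \<beta>_def n_def\<close>)
  also have "\<dots> = x\<^sup>2 * (1 + 2 * ((1 - q) + k * q) / n) + 2 + k * (D\<^sup>2 - \<theta>\<^sup>2 * W\<^sup>2) / (2 * n\<^sup>2)"
  proof -
    have x: "x = \<alpha> + k * \<beta>" and D: "D = \<alpha> + \<beta>" and W: "W = \<alpha> - \<beta>"
      by (simp_all add: x_def D_def W_def signed_sum_def \<alpha>_def \<beta>_def s_def)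
    \<comment> \<open>Exchanging the types multiplies a signed sum by \<open>k\<close>, because
      \<open>k\<close> is its own inverse.\<close>
    have "((1 - q) * \<alpha> + q * \<beta>) + k * ((1 - q) * \<beta> + q * \<alpha>) = ((1 - q) + k * q) * x"
      using k by (auto simp: x algebra_simps)
    then have 1: "((1 - q) * \<alpha> + q * \<beta>) / n + k * (((1 - q) * \<beta> + q * \<alpha>) / n)
        = ((1 - q) + k * q) * x / n"
      by (simp add: add_divide_distrib[symmetric])
    \<comment> \<open>The two factors are \<open>(D + \<theta> * W) / 2\<close> and
      \<open>(D - \<theta> * W) / 2\<close>, so their product is a difference of squares.\<close>
    have "4 * (((1 - q) * \<alpha> + q * \<beta>) * ((1 - q) * \<beta> + q * \<alpha>)) = D\<^sup>2 - \<theta>\<^sup>2 * W\<^sup>2"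
      by (simp add: D W \<theta>_def power2_eq_square algebra_simps)
    moreover have "2 * k * (a / n) * (b / n) = k * (4 * (a * b)) / (2 * n\<^sup>2)" for a b
      using n by (simp add: field_simps power2_eq_square)
    ultimately have 2: "2 * k * (((1 - q) * \<alpha> + q * \<beta>) / n) * (((1 - q) * \<beta> + q * \<alpha>) / n)
        = k * (D\<^sup>2 - \<theta>\<^sup>2 * W\<^sup>2) / (2 * n\<^sup>2)"
      by metis
    show ?thesis unfolding 1 2 by (simp add: power2_eq_square algebra_simps)
  qed
  finally show ?thesis .
qed

text \<open>The conditional step is affine in the squares of \<open>D\<close> and \<open>W\<close>,
  so averaging over the current tree closes the system of two second moments.\<close>

lemma second_moment_Suc:
  fixes m :: nat
  assumes q: "0 \<le> q" "q \<le> 1" and k: "k \<in> {1, -1}"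
  defines "n \<equiv> real (Suc m)"
  shows "second_moment k q (Suc m) = second_moment k q m * (1 + 2 * ((1 - q) + k * q) / n) + 2
    + k * (second_moment 1 q m - (1 - 2 * q)\<^sup>2 * second_moment (-1) q m) / (2 * n\<^sup>2)"
proof -
  let ?E = "measure_pmf.expectation (coloured q m)"
  let ?u = "\<lambda>k G. (signed_sum k (Suc m) G)\<^sup>2"
  have [simp]: "integrable (coloured q m) f" for f :: "_ \<Rightarrow> real"
    by (auto intro: integrable_measure_pmf_finite)
  have "second_moment k q (Suc m) = ?E (\<lambda>G.
      measure_pmf.expectation (parent_pmf q (Suc m) Type_A) (\<lambda>a.
        measure_pmf.expectation (parent_pmf q (Suc m) Type_B) (\<lambda>b.
          (signed_sum k (Suc (Suc m)) (grow m a b G))\<^sup>2)))"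
    by (simp add: second_moment_def expectation_bind_pmf_finite)
  also have "\<dots> = ?E (\<lambda>G. ?u k G * (1 + 2 * ((1 - q) + k * q) / n) + 2
      + k * (?u 1 G - (1 - 2 * q)\<^sup>2 * ?u (-1) G) / (2 * n\<^sup>2))"
    unfolding n_def
    by (rule integral_cong_AE, simp, simp, rule AE_pmfI, rule expectation_signed_sum_step[OF q k])
  also have "\<dots> = second_moment k q m * (1 + 2 * ((1 - q) + k * q) / n) + 2
    + k * (second_moment 1 q m - (1 - 2 * q)\<^sup>2 * second_moment (-1) q m) / (2 * n\<^sup>2)"
    by (simp add: second_moment_def)
  finally show ?thesis .
qed

lemma second_moment_0: "second_moment 1 q 0 = 0" "second_moment (-1) q 0 = 4"
  by (simp_all add: second_moment_def signed_sum_def colour_sum_def)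

lemma sum_nodes: "sum s (nodes n) = colour_sum n s Type_A + colour_sum n s Type_B"
proof (induction n)
  case (Suc n)
  have "(Suc n, t) \<notin> nodes n" for t by (simp add: nodes_def)
  then show ?case using Suc by (simp add: nodes_Suc colour_sum_def)
qed (simp add: nodes_def colour_sum_def)

text \<open>The two comparisons feed each other and need a joint induction. With
  \<open>n = m + 1\<close> the lower bound is \<open>c * n * (n + 1)\<close>, which solves
  \<open>x' = (1 + 2 / n) * x\<close> exactly. At \<open>m = 0\<close> the tree is the bare root
  edge, \<open>D\<close> vanishes for every \<open>q\<close>, and there is no gap yet.\<close>

lemma second_moment_gap:
  assumes q: "0 \<le> q0" "q0 < q1" "q1 \<le> 1 / 2"
  defines "\<theta>0 \<equiv> 1 - 2 * q0" and "\<theta>1 \<equiv> 1 - 2 * q1"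
  defines "c \<equiv> (\<theta>0\<^sup>2 - \<theta>1\<^sup>2) / 3"
  shows "second_moment (-1) q1 m \<le> second_moment (-1) q0 m
    \<and> (if m = 0 then 0 else c * real (m + 1) * real (m + 2))
      \<le> second_moment 1 q1 m - second_moment 1 q0 m"
proof (induction m)
  case 0
  show ?case by (simp add: second_moment_0)
next
  case (Suc m)
  define n where "n = real (Suc m)"
  have n: "n \<ge> 1" by (simp add: n_def)
  have \<theta>: "0 \<le> \<theta>1" "\<theta>1 < \<theta>0" using q by (auto simp: \<theta>0_def \<theta>1_def)
  then have \<theta>2: "\<theta>1\<^sup>2 < \<theta>0\<^sup>2" by (simp add: power_strict_mono)
  then have c: "c > 0" by (simp add: c_def)
  let ?u0 = "second_moment 1 q0 m" and ?u1 = "second_moment 1 q1 m"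
  let ?v0 = "second_moment (-1) q0 m" and ?v1 = "second_moment (-1) q1 m"
  have v: "?v1 \<le> ?v0" "0 \<le> ?v1" using Suc by (auto simp: second_moment_nonneg)
  have "0 \<le> (if m = 0 then 0 else c * real (m + 1) * real (m + 2))" using c by simp
  then have u: "?u0 \<le> ?u1" using Suc by linarith
  have step1: "second_moment 1 q (Suc m) = second_moment 1 q m * (1 + 2 / n) + 2
      + (second_moment 1 q m - (1 - 2 * q)\<^sup>2 * second_moment (-1) q m) / (2 * n\<^sup>2)"
    and step2: "second_moment (-1) q (Suc m)
      = second_moment (-1) q m * (1 + 2 * (1 - 2 * q) / n) + 2
      + ((1 - 2 * q)\<^sup>2 * second_moment (-1) q m - second_moment 1 q m) / (2 * n\<^sup>2)"
    if "0 \<le> q" "q \<le> 1" for q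
    using second_moment_Suc[OF that, of 1 m] second_moment_Suc[OF that, of "-1" m]
    by (simp_all add: n_def algebra_simps)
  \<comment> \<open>This product enters the two recursions with opposite signs, so the one
    inequality serves both halves of the induction.\<close>
  have tv: "\<theta>1\<^sup>2 * ?v1 \<le> \<theta>0\<^sup>2 * ?v0"
    using \<theta>2 v by (intro mult_mono) auto
  have "second_moment (-1) q1 (Suc m) \<le> second_moment (-1) q0 (Suc m)"
  proof -
    have "?v1 * (1 + 2 * \<theta>1 / n) \<le> ?v0 * (1 + 2 * \<theta>0 / n)"
      using v \<theta> n by (intro mult_mono add_mono divide_right_mono) auto
    moreover have "(\<theta>1\<^sup>2 * ?v1 - ?u1) / (2 * n\<^sup>2) \<le> (\<theta>0\<^sup>2 * ?v0 - ?u0) / (2 * n\<^sup>2)"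
      using tv u by (intro divide_right_mono) auto
    ultimately show ?thesis
      using q by (simp add: step2 \<theta>0_def \<theta>1_def)
  qed
  moreover have "c * real (Suc m + 1) * real (Suc m + 2)
      \<le> second_moment 1 q1 (Suc m) - second_moment 1 q0 (Suc m)"
  proof (cases "m = 0")
    \<comment> \<open>The gap is created here: from \<open>D = 0\<close> and
      \<open>W\<^sup>2 = 4\<close> the first step gives \<open>2 - 2 * \<theta>\<^sup>2\<close>. The
      difference is exactly \<open>6 * c\<close>, which explains the factor 3 in
      \<open>c\<close>.\<close>
    case True
    then show ?thesis
      using q step1[of q0] step1[of q1]
      by (simp add: second_moment_0 n_def c_def \<theta>0_def \<theta>1_def)
  next
    case False
    \<comment> \<open>The coupling terms can only widen the gap; discarding their difference leaves
      the factor \<open>1 + 2 / n\<close>.\<close>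
    have "(?u0 - \<theta>0\<^sup>2 * ?v0) / (2 * n\<^sup>2) \<le> (?u1 - \<theta>1\<^sup>2 * ?v1) / (2 * n\<^sup>2)"
      using tv u by (intro divide_right_mono) auto
    then have "(?u1 - ?u0) * (1 + 2 / n) \<le> second_moment 1 q1 (Suc m) - second_moment 1 q0 (Suc m)"
      using q by (simp add: step1 \<theta>0_def \<theta>1_def left_diff_distrib)
    moreover have "c * n * (n + 1) * (1 + 2 / n) \<le> (?u1 - ?u0) * (1 + 2 / n)"
      using Suc False n by (intro mult_right_mono) (auto simp: n_def add_ac)
    moreover have "c * n * (n + 1) * (1 + 2 / n) = c * (n + 1) * (n + 2)"
      using n by (simp add: field_simps)
    ultimately have "c * (n + 1) * (n + 2) \<le> second_moment 1 q1 (Suc m) - second_moment 1 q0 (Suc m)"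
      by linarith
    then show ?thesis by (simp add: n_def add_ac)
  qed
  ultimately show ?case by simp
qed

section \<open>The test\<close>

text \<open>Links the observable to the recursion: its mean is the second moment for
  \<open>k = 1\<close>. The second claim counts the nodes and normalises the statistic to
  \<open>[0,1]\<close>.\<close>

lemma imbalance_coloured:
  assumes "G \<in> set_pmf (coloured q m)"
  shows "imbalance (unlabelled (nodes (Suc m), fst G, root_edge)) = (signed_sum 1 (Suc m) G)\<^sup>2"
    and "\<bar>signed_sum 1 (Suc m) G\<bar> \<le> 2 * real (Suc m)"
proof -
  obtain E s where Es: "G = (E, s)" by (cases G)
  have G: "E \<subseteq> Pow (nodes (Suc m))" "splits (nodes (Suc m), E, root_edge) s"
    "\<And>s'. splits (nodes (Suc m), E, root_edge) s' \<Longrightarrow>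
       \<exists>c\<in>{1, -1}. \<forall>x\<in>nodes (Suc m). s' x = c * s x"
    using uniquely_split_coloured[OF assms] by (auto simp: uniquely_split_def Es)
  have D: "signed_sum 1 (Suc m) G = sum s (nodes (Suc m))"
    by (simp add: signed_sum_def sum_nodes Es)
  have "root_edge \<subseteq> nodes (Suc m)" by (auto simp: root_edge_def nodes_def)
  then show "imbalance (unlabelled (nodes (Suc m), fst G, root_edge)) = (signed_sum 1 (Suc m) G)\<^sup>2"
    using imbalance_unlabelled[OF G(1) _ G(2,3)] by (simp add: D[unfolded Es] Es)
  have "\<bar>sum s (nodes (Suc m))\<bar> \<le> (\<Sum>x\<in>nodes (Suc m). \<bar>s x\<bar>)" by (rule sum_abs)
  also have "\<dots> \<le> (\<Sum>x\<in>nodes (Suc m). 1)"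
    using G(2) by (intro sum_mono) (use splits_colour in fastforce)
  also have "\<dots> = 2 * real (Suc m)"
    by (simp add: nodes_def card_cartesian_product UNIV_community)
  finally show "\<bar>signed_sum 1 (Suc m) G\<bar> \<le> 2 * real (Suc m)" by (simp add: D)
qed

lemma rooted_unlabelled_bcmrt_Suc:
  "rooted_unlabelled_bcmrt q (Suc m) =
     map_pmf (\<lambda>G. unlabelled (nodes (Suc m), fst G, root_edge)) (coloured q m)"
  by (simp add: rooted_unlabelled_bcmrt_def map_fst_coloured[symmetric] map_pmf_comp)

lemma optimal_risk_bound:
  assumes q: "0 \<le> q0" "q0 < q1" "q1 \<le> 1 / 2" and n: "n \<ge> 2"
  shows "optimal_risk q0 q1 n \<le> 1 / 2 - ((1 - 2 * q0)\<^sup>2 - (1 - 2 * q1)\<^sup>2) / 24"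
proof -
  define m where "m = n - 1"
  have m: "n = Suc m" "m \<noteq> 0" using n by (auto simp: m_def)
  let ?P = "\<lambda>q. rooted_unlabelled_bcmrt q n"
  define f where "f X = imbalance X / (2 * real n)\<^sup>2" for X :: "node rooted_graph set"
  have fin: "finite (set_pmf (?P q))" for q by (simp add: m rooted_unlabelled_bcmrt_Suc)
  have f01: "0 \<le> f X \<and> f X \<le> 1" if X: "X \<in> set_pmf (?P q)" for X q
  proof -
    obtain G where G: "G \<in> set_pmf (coloured q m)"
      "X = unlabelled (nodes (Suc m), fst G, root_edge)"
      using X unfolding m(1) rooted_unlabelled_bcmrt_Suc set_map_pmf by blast
    have "(signed_sum 1 (Suc m) G)\<^sup>2 \<le> (2 * real n)\<^sup>2"
      using imbalance_coloured(2)[OF G(1)] by (simp add: m abs_le_square_iff[symmetric])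
    then show ?thesis
      using imbalance_coloured(1)[OF G(1)] by (simp add: f_def G(2) m divide_le_eq)
  qed
  have Ef: "measure_pmf.expectation (?P q) f = second_moment 1 q m / (2 * real n)\<^sup>2" for q
  proof -
    have "measure_pmf.expectation (?P q) f
        = measure_pmf.expectation (coloured q m) (\<lambda>G. (signed_sum 1 (Suc m) G)\<^sup>2 / (2 * real n)\<^sup>2)"
      unfolding m(1) rooted_unlabelled_bcmrt_Suc integral_map_pmf
      by (intro integral_cong_AE AE_pmfI) (auto simp: f_def imbalance_coloured(1) m)
    then show ?thesis by (simp add: second_moment_def)
  qed
  obtain \<phi> where \<phi>: "measure_pmf.expectation (?P q1) f - measure_pmf.expectation (?P q0) f
      \<le> measure_pmf.prob (?P q1) {x. \<phi> x} - measure_pmf.prob (?P q0) {x. \<phi> x}"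
    by (rule ex_test_of_expectation_gap[OF fin fin, of q0 q1 f]) (use f01 in auto)
  let ?c = "((1 - 2 * q0)\<^sup>2 - (1 - 2 * q1)\<^sup>2) / 3"
  have "(1 - 2 * q1)\<^sup>2 \<le> (1 - 2 * q0)\<^sup>2" using q by (intro power_mono) auto
  then have c: "0 \<le> ?c" by simp
  \<comment> \<open>The gap \<open>?c * n * (n + 1)\<close> is weakened to
    \<open>?c * n * n\<close>, so that dividing by the normalisation leaves \<open>?c / 4\<close>,
    free of \<open>n\<close>.\<close>
  have "?c / 4 * (2 * real n)\<^sup>2 = ?c * real n * real n" by (simp add: power2_eq_square)
  also have "\<dots> \<le> ?c * real (m + 1) * real (m + 2)"
    using c by (intro mult_mono) (auto simp: m)
  also have "\<dots> \<le> second_moment 1 q1 m - second_moment 1 q0 m"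
    using second_moment_gap[OF q, of m] m(2) by simp
  finally have "?c / 4 \<le> (second_moment 1 q1 m - second_moment 1 q0 m) / (2 * real n)\<^sup>2"
    using m by (subst pos_le_divide_eq) auto
  then have gap: "?c / 4 \<le> measure_pmf.prob (?P q1) {x. \<phi> x} - measure_pmf.prob (?P q0) {x. \<phi> x}"
    using \<phi> by (simp add: Ef diff_divide_distrib)
  have "measure_pmf.prob (?P q1) {x. \<not> \<phi> x} = 1 - measure_pmf.prob (?P q1) {x. \<phi> x}"
    using measure_pmf.prob_compl[of "{x. \<phi> x}" "?P q1"] by (simp add: Compl_eq_Diff_UNIV[symmetric] Collect_neg_eq)
  \<comment> \<open>The risk is one half minus half the difference of rejection probabilities, hence
    24 = 3 * 4 * 2.\<close>
  then have "risk q0 q1 n \<phi> \<le> 1 / 2 - ((1 - 2 * q0)\<^sup>2 - (1 - 2 * q1)\<^sup>2) / 24"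
    using gap by (simp add: risk_def field_simps)
  moreover have "optimal_risk q0 q1 n \<le> risk q0 q1 n \<phi>"
    unfolding optimal_risk_def by (rule cINF_lower[OF bdd_below_risk]) simp
  ultimately show ?thesis by linarith
qed

theorem theorem7:
  fixes q0 q1 :: real
  assumes "0 \<le> q0" and "q0 < q1" and "q1 \<le> 1 / 2"
  shows "(SUP n\<in>{2::nat..}. optimal_risk q0 q1 n) < 1 / 2"
proof -
  define c where "c = ((1 - 2 * q0)\<^sup>2 - (1 - 2 * q1)\<^sup>2) / 24"
  have "(1 - 2 * q1)\<^sup>2 < (1 - 2 * q0)\<^sup>2"
    using assms by (intro power_strict_mono) auto
  then have "0 < c" by (simp add: c_def)
  moreover have "(SUP n\<in>{2::nat..}. optimal_risk q0 q1 n) \<le> 1 / 2 - c"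
    unfolding c_def using optimal_risk_bound[OF assms] by (intro cSUP_least) auto
  ultimately show ?thesis by linarith
qed

end
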